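(* Let $d\geq 2$, let $L$ be a positive even integer, and consider the torus $(\mathbb{T}_L,\mathcal{E}_L)$. Let $R$ be a reflection plane bisecting edges, with corresponding reflection operator $\Theta$ and halves $\mathbb{T}_L^{\pm}$. Consider the random path model with $N\in\mathbb{N}_{>0}$, inverse temperature $\beta\geq 0$ and weight function $U:\mathbb{N}^{2N+1}\to\mathbb{R}_{\geq 0}$, such that $\mu_{L,N,\beta,U}$ has finite mass and $Z^{\mathrm{field}}_{L,N,\beta,U}(\boldsymbol{k})$ is finite for every real vector $\boldsymbol{k}=(k_x)_{x\in\mathbb{T}_L}$ with $k_x\leq 1$ for all $x$. Then for every $\boldsymbol{h}=(h_x)_{x\in\mathbb{T}_L}\in\mathbb{R}^{\mathbb{T}_L}$, $$Z^{(2)}_{L,N,\beta,U}(\boldsymbol{h})\leq\frac{Z^{(2)}_{L,N,\beta,U}(\boldsymbol{h}^+)+Z^{(2)}_{L,N,\beta,U}(\boldsymbol{h}^-)}{2}.$$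
   Context: Random path model. $\mathbb{N}=\{0,1,2,\dots\}$. Let $\mathcal{G}=(\mathcal{V},\mathcal{E})$ be an undirected, simple, finite graph and $N\in\mathbb{N}_{>0}$ (number of colours). A link configuration is $m=(m_e)_{e\in\mathcal{E}}\in\mathbb{N}^{\mathcal{E}}$; $m_e$ is the number of links on $e$, and $(e,p)$, $1\leq p\leq m_e$, denotes the $p$-th link on $e$. A colouring of $m$ is $c=(c_e)_{e\in\mathcal{E}}$ with $c_e\in\{1,\dots,N\}^{m_e}$; $c_e(p)$ is the colour of the link $(e,p)$, and a link of colour $i$ is called an $i$-link. A link touches $x$ if it lies on an edge incident to $x$. A pairing for $(m,c)$ is $\pi=(\pi_x)_{x\in\mathcal{V}}$, where $\pi_x$ pairs some of the links touching $x$: each link touching $x$ is paired at $x$ to at most one other link touching $x$ (never to itself), links may be left unpaired at $x$, and two links paired at $x$ must have the same colour. A wire configuration is a triple $w=(m,c,\pi)$; $\mathcal{W}_{\mathcal{G}}$ is the set of all wire configurations. For $w\in\mathcal{W}_{\mathcal{G}}$, $x\in\mathcal{V}$, $i\in\{1,\dots,N\}$: $u^i_x(w)$ is the number of $i$-links touching $x$ which are not paired to any other link at $x$; $v^i_x(w)$ is the number of $i$-links touching $x$ which are paired at $x$ to another link; $n^i_x(w)=v^i_x(w)/2+u^i_x(w)$; $t_x(w)$ is the number of links incident to $x$ that are paired at $x$ with another link on the same edge. Write $\mathbf{n}_x=(n^1_x,\dots,n^N_x)$, $\mathbf{u}_x=(u^1_x,\dots,u^N_x)$. For $\beta\geq 0$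 and a weight function $U:\mathbb{N}^{2N+1}\to\mathbb{R}_{\geq 0}$, put $U_x(w)=U(\mathbf{n}_x(w),\mathbf{u}_x(w),t_x(w))$ and $$\mu_{\mathcal{G},N,\beta,U}(w)=\prod_{e\in\mathcal{E}}\frac{\beta^{m_e(w)}}{m_e(w)!}\prod_{x\in\mathcal{V}}U_x(w),\qquad \mu_{\mathcal{G},N,\beta,U}(f)=\sum_{w\in\mathcal{W}_{\mathcal{G}}}f(w)\mu_{\mathcal{G},N,\beta,U}(w).$$ It has finite mass if $\mu_{\mathcal{G},N,\beta,U}(1)<\infty$. For the torus $\mathcal{G}=(\mathbb{T}_L,\mathcal{E}_L)$, $\mathbb{T}_L=\mathbb{Z}^d/L\mathbb{Z}^d$ with nearest-neighbour edges, write $\mu_{L,N,\beta,U}$; $\mathbb{T}_L$ is identified with $[0,L)^d\cap\mathbb{Z}^d$. For distinct $x,y\in\mathbb{T}_L$, $Z_{L,N,\beta,U}(x,y)$ is the $\mu_{L,N,\beta,U}$-mass of the set of $w$ with $u^1_x(w)=u^1_y(w)=1$ and $u^1_z(w)=0$ for $z\notin\{x,y\}$; $Z_{L,N,\beta,U}(x,x)$ is the $\mu_{L,N,\beta,U}$-mass of the set of $w$ with $u^1_x(w)=2$ and $u^1_z(w)=0$ for $z\neq x$. For $\boldsymbol{h}\in\mathbb{R}^{\mathbb{T}_L}$, $$Z^{\mathrm{field}}_{L,N,\beta,U}(\boldsymbol{h})=\mu_{L,N,\beta,U}\Big(\prod_{x\in\mathbb{T}_L}h_x^{u^1_x(w)}\Big)\quad(0^0=1),$$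 $$Z^{(2)}_{L,N,\beta,U}(\boldsymbol{h})=\sum_{x\in\mathbb{T}_L}Z_{L,N,\beta,U}(x,x)h_x^2+\frac12\sum_{x,y\in\mathbb{T}_L:\,x\neq y}Z_{L,N,\beta,U}(x,y)h_xh_y,$$ the last sum being over ordered pairs of distinct sites. Reflection through edges. $R=\{z\in\mathbb{R}^d: z\cdot\boldsymbol{e}_i=u\}$ for some $i\in\{1,\dots,d\}$ and $u$ with $u-\frac12\in\mathbb{Z}\cap[0,L)$. The reflection $\Theta:\mathbb{T}_L\to\mathbb{T}_L$ is $\Theta(x)_k=x_k$ for $k\neq i$ and $\Theta(x)_i=2u-x_i \bmod L$. $\mathbb{T}_L^+,\mathbb{T}_L^-$ is the corresponding partition of the torus into two disjoint halves with $\Theta(\mathbb{T}_L^{\pm})=\mathbb{T}_L^{\mp}$: one half consists of the $x$ with $x_i\in\{u+\frac12,u+\frac32,\dots,u-\frac12+\frac L2\}$ mod $L$ and the other is its complement. For $\boldsymbol{h}\in\mathbb{R}^{\mathbb{T}_L}$, the fields $\boldsymbol{h}^{\pm}$ are defined by $h^{\pm}_x=h_x$ if $x\in\mathbb{T}_L^{\pm}$ and $h^{\pm}_x=h_{\Theta x}$ if $x\in\mathbb{T}_L^{\mp}$. *)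

theory Defs
  imports "HOL-Analysis.Infinite_Sum" "HOL-Library.FuncSet" "HOL-Library.Disjoint_Sets"
begin

section \<open>Wire configurations on a graph\<close>

text \<open>
  A graph is given by its vertex set \<open>V\<close> and its edge set \<open>E\<close>, a set of two-element subsets
  of \<open>V\<close>. The link \<open>(e, p)\<close> is the \<open>p\<close>-th link on the edge \<open>e\<close>, counted from 1.
  All families are extensional functions (equal to \<open>undefined\<close> off their index set), so that
  each wire configuration is represented by exactly one triple \<open>(m, c, \<pi>)\<close>.
\<close>

type_synonym 'v link = "'v set \<times> nat"

type_synonym 'v wire =
  "('v set \<Rightarrow> nat) \<times> ('v set \<Rightarrow> nat \<Rightarrow> nat) \<times> ('v \<Rightarrow> 'v link set set)"

definition links_at :: "'v set set \<Rightarrow> ('v set \<Rightarrow> nat) \<Rightarrow> 'v \<Rightarrow> 'v link set" where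
  "links_at E m x = {(e, p). e \<in> E \<and> x \<in> e \<and> 1 \<le> p \<and> p \<le> m e}"

definition link_configs :: "'v set set \<Rightarrow> ('v set \<Rightarrow> nat) set" where
  "link_configs E = E \<rightarrow>\<^sub>E UNIV"

definition colourings ::
    "'v set set \<Rightarrow> nat \<Rightarrow> ('v set \<Rightarrow> nat) \<Rightarrow> ('v set \<Rightarrow> nat \<Rightarrow> nat) set" where
  "colourings E N m = (\<Pi>\<^sub>E e\<in>E. {1..m e} \<rightarrow>\<^sub>E {1..N})"

text \<open>
  A pairing at \<open>x\<close> is the set of its unordered pairs of links; disjointness of the pairs says
  that each link is paired at \<open>x\<close> to at most one other link.
\<close>

definition pairings_at ::
    "'v set set \<Rightarrow> ('v set \<Rightarrow> nat) \<Rightarrow> ('v set \<Rightarrow> nat \<Rightarrow> nat) \<Rightarrow> 'v \<Rightarrow> 'v link set set set" where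
  "pairings_at E m c x =
     {P. P \<subseteq> {{(e, p), (e', p')} | e p e' p'.
               (e, p) \<in> links_at E m x \<and> (e', p') \<in> links_at E m x \<and>
               (e, p) \<noteq> (e', p') \<and> c e p = c e' p'} \<and>
         disjoint P}"

definition pairings ::
    "'v set \<Rightarrow> 'v set set \<Rightarrow> ('v set \<Rightarrow> nat) \<Rightarrow> ('v set \<Rightarrow> nat \<Rightarrow> nat)
      \<Rightarrow> ('v \<Rightarrow> 'v link set set) set" where
  "pairings V E m c = (\<Pi>\<^sub>E x\<in>V. pairings_at E m c x)"

definition wires :: "'v set \<Rightarrow> 'v set set \<Rightarrow> nat \<Rightarrow> 'v wire set" where
  "wires V E N =
     {(m, c, \<pi>). m \<in> link_configs E \<and> c \<in> colourings E N m \<and> \<pi> \<in> pairings V E m c}"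

definition num_unpaired :: "'v set set \<Rightarrow> nat \<Rightarrow> 'v \<Rightarrow> 'v wire \<Rightarrow> nat" where
  "num_unpaired E i x w = (case w of (m, c, \<pi>) \<Rightarrow>
     card {(e, p). (e, p) \<in> links_at E m x \<and> c e p = i \<and> (e, p) \<notin> \<Union> (\<pi> x)})"

definition num_paired :: "'v set set \<Rightarrow> nat \<Rightarrow> 'v \<Rightarrow> 'v wire \<Rightarrow> nat" where
  "num_paired E i x w = (case w of (m, c, \<pi>) \<Rightarrow>
     card {(e, p). (e, p) \<in> links_at E m x \<and> c e p = i \<and> (e, p) \<in> \<Union> (\<pi> x)})"

text \<open>
  The division is exact: paired links have equal colours, so the number of paired \<open>i\<close>-links
  at \<open>x\<close> is even.
\<close>

definition local_time :: "'v set set \<Rightarrow> nat \<Rightarrow> 'v \<Rightarrow> 'v wire \<Rightarrow> nat" where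
  "local_time E i x w = num_paired E i x w div 2 + num_unpaired E i x w"

definition num_same_edge :: "'v set set \<Rightarrow> 'v \<Rightarrow> 'v wire \<Rightarrow> nat" where
  "num_same_edge E x w = (case w of (m, c, \<pi>) \<Rightarrow>
     card {(e, p). (e, p) \<in> links_at E m x \<and> (\<exists>q. q \<noteq> p \<and> {(e, p), (e, q)} \<in> \<pi> x)})"

section \<open>The random path measure\<close>

text \<open>
  A weight function on \<open>\<nat>\<^sup>2\<^sup>N\<^sup>+\<^sup>1\<close> takes two vectors of \<open>\<nat>\<^sup>N\<close>, represented as elements of
  \<open>{1..N} \<rightarrow>\<^sub>E UNIV\<close>, and a natural number. Its values at non-extensional arguments play no role.
\<close>

type_synonym weight = "(nat \<Rightarrow> nat) \<Rightarrow> (nat \<Rightarrow> nat) \<Rightarrow> nat \<Rightarrow> real"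

definition nonneg_weight :: "nat \<Rightarrow> weight \<Rightarrow> bool" where
  "nonneg_weight N U \<longleftrightarrow>
     (\<forall>n \<in> {1..N} \<rightarrow>\<^sub>E UNIV. \<forall>u \<in> {1..N} \<rightarrow>\<^sub>E UNIV. \<forall>t. 0 \<le> U n u t)"

definition vertex_weight :: "'v set set \<Rightarrow> nat \<Rightarrow> weight \<Rightarrow> 'v \<Rightarrow> 'v wire \<Rightarrow> real" where
  "vertex_weight E N U x w =
     U (\<lambda>i\<in>{1..N}. local_time E i x w) (\<lambda>i\<in>{1..N}. num_unpaired E i x w) (num_same_edge E x w)"

definition path_weight ::
    "'v set \<Rightarrow> 'v set set \<Rightarrow> nat \<Rightarrow> real \<Rightarrow> weight \<Rightarrow> 'v wire \<Rightarrow> real" where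
  "path_weight V E N \<beta> U w =
     (\<Prod>e\<in>E. \<beta> ^ fst w e / fact (fst w e)) * (\<Prod>x\<in>V. vertex_weight E N U x w)"

text \<open>
  Sums over wire configurations are unordered, so for real-valued \<open>f\<close> convergence
  means absolute convergence.
\<close>

definition path_finite ::
    "'v set \<Rightarrow> 'v set set \<Rightarrow> nat \<Rightarrow> real \<Rightarrow> weight \<Rightarrow> ('v wire \<Rightarrow> real) \<Rightarrow> bool" where
  "path_finite V E N \<beta> U f \<longleftrightarrow> (\<lambda>w. f w * path_weight V E N \<beta> U w) summable_on wires V E N"

definition path_sum ::
    "'v set \<Rightarrow> 'v set set \<Rightarrow> nat \<Rightarrow> real \<Rightarrow> weight \<Rightarrow> ('v wire \<Rightarrow> real) \<Rightarrow> real" where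
  "path_sum V E N \<beta> U f = (\<Sum>\<^sub>\<infinity>w\<in>wires V E N. f w * path_weight V E N \<beta> U w)"

definition finite_mass :: "'v set \<Rightarrow> 'v set set \<Rightarrow> nat \<Rightarrow> real \<Rightarrow> weight \<Rightarrow> bool" where
  "finite_mass V E N \<beta> U \<longleftrightarrow> path_finite V E N \<beta> U (\<lambda>w. 1)"

definition field_observable :: "'v set \<Rightarrow> 'v set set \<Rightarrow> ('v \<Rightarrow> real) \<Rightarrow> 'v wire \<Rightarrow> real" where
  "field_observable V E h w = (\<Prod>x\<in>V. h x ^ num_unpaired E 1 x w)"

text \<open>
  \<open>Z_field\<close> is a junk value unless the defining series converges, that is, unless
  \<open>Z_field_finite\<close> holds.
\<close>

definition Z_field ::
    "'v set \<Rightarrow> 'v set set \<Rightarrow> nat \<Rightarrow> real \<Rightarrow> weight \<Rightarrow> ('v \<Rightarrow> real) \<Rightarrow> real" where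
  "Z_field V E N \<beta> U h = path_sum V E N \<beta> U (field_observable V E h)"

definition Z_field_finite ::
    "'v set \<Rightarrow> 'v set set \<Rightarrow> nat \<Rightarrow> real \<Rightarrow> weight \<Rightarrow> ('v \<Rightarrow> real) \<Rightarrow> bool" where
  "Z_field_finite V E N \<beta> U h \<longleftrightarrow> path_finite V E N \<beta> U (field_observable V E h)"

definition two_point_event :: "'v set \<Rightarrow> 'v set set \<Rightarrow> 'v \<Rightarrow> 'v \<Rightarrow> 'v wire \<Rightarrow> bool" where
  "two_point_event V E x y w \<longleftrightarrow>
     (if x = y then num_unpaired E 1 x w = 2
      else num_unpaired E 1 x w = 1 \<and> num_unpaired E 1 y w = 1) \<and>
     (\<forall>z \<in> V - {x, y}. num_unpaired E 1 z w = 0)"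

definition Z_two_point ::
    "'v set \<Rightarrow> 'v set set \<Rightarrow> nat \<Rightarrow> real \<Rightarrow> weight \<Rightarrow> 'v \<Rightarrow> 'v \<Rightarrow> real" where
  "Z_two_point V E N \<beta> U x y = path_sum V E N \<beta> U (\<lambda>w. of_bool (two_point_event V E x y w))"

definition Z2 ::
    "'v set \<Rightarrow> 'v set set \<Rightarrow> nat \<Rightarrow> real \<Rightarrow> weight \<Rightarrow> ('v \<Rightarrow> real) \<Rightarrow> real" where
  "Z2 V E N \<beta> U h =
     (\<Sum>x\<in>V. Z_two_point V E N \<beta> U x x * (h x)\<^sup>2) +
     1 / 2 * (\<Sum>x\<in>V. \<Sum>y\<in>V - {x}. Z_two_point V E N \<beta> U x y * h x * h y)"

section \<open>The torus and reflections through edges\<close>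

text \<open>
  Sites are the representatives in \<open>{0..<L}\<^sup>d\<close>, with coordinates indexed by \<open>{..<d}\<close>.
  For \<open>L = 2\<close> the sites \<open>x + e\<^sub>i\<close> and \<open>x - e\<^sub>i\<close> coincide and are joined to \<open>x\<close> by a single edge.
\<close>

type_synonym site = "nat \<Rightarrow> int"

definition torus :: "nat \<Rightarrow> int \<Rightarrow> site set" where
  "torus d L = {..<d} \<rightarrow>\<^sub>E {0..<L}"

definition torus_edges :: "nat \<Rightarrow> int \<Rightarrow> site set set" where
  "torus_edges d L = {{x, x(i := (x i + 1) mod L)} | x i. x \<in> torus d L \<and> i < d}"

text \<open>
  The plane \<open>z \<bullet> e\<^sub>i = u\<close> with \<open>u = a + 1/2\<close>, \<open>a \<in> {0..<L}\<close>, is represented by the pair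
  \<open>(i, a)\<close>; thus \<open>2 u = 2 a + 1\<close>, and the first half consists of the sites with
  \<open>x i \<in> {u + 1/2, \<dots>, u - 1/2 + L/2} = {a + 1, \<dots>, a + L/2}\<close> modulo \<open>L\<close>.
\<close>

definition reflect :: "int \<Rightarrow> nat \<Rightarrow> int \<Rightarrow> site \<Rightarrow> site" where
  "reflect L i a x = x(i := (2 * a + 1 - x i) mod L)"

definition half_plus :: "nat \<Rightarrow> int \<Rightarrow> nat \<Rightarrow> int \<Rightarrow> site set" where
  "half_plus d L i a = {x \<in> torus d L. \<exists>b \<in> {a + 1..a + L div 2}. x i = b mod L}"

definition half_minus :: "nat \<Rightarrow> int \<Rightarrow> nat \<Rightarrow> int \<Rightarrow> site set" where
  "half_minus d L i a = torus d L - half_plus d L i a"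

definition reflected_field :: "site set \<Rightarrow> (site \<Rightarrow> site) \<Rightarrow> (site \<Rightarrow> real) \<Rightarrow> site \<Rightarrow> real" where
  "reflected_field S \<theta> h x = (if x \<in> S then h x else h (\<theta> x))"

end

theory Submission
  imports Defs
begin

text \<open>
  The inequality comes down to reflection positivity of the part of the two-point function that
  couples the two halves of the torus. Write \<open>P\<close> for the half on one side of the plane,
  \<open>\<theta>\<close> for the reflection, and \<open>Z(x, y)\<close> for the two-point function. Split the quadratic form
  \<open>Z2(h)\<close> into pairs of sites in the same half and pairs in opposite halves. Since
  \<open>Z(\<theta> x, \<theta> y) = Z(x, y)\<close>, the contributions of pairs in the same half to \<open>Z2(h)\<close> and to the mean of
  \<open>Z2(h\<^sup>+)\<close> and \<open>Z2(h\<^sup>-)\<close> agree, and what is left is a quadratic form in the antisymmetric part of the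
  field:
  \<open>Z2(h\<^sup>+) + Z2(h\<^sup>-) - 2 Z2(h) = \<Sum>x\<in>P. \<Sum>y\<in>P. Z(x, \<theta> y) g(x) g(y)\<close> with \<open>g(x) = h(x) - h(\<theta> x)\<close>.

  That this form is nonnegative is \<open>reflection_positivity\<close>. Every edge lies in one half or is
  mapped to itself by \<open>\<theta>\<close>, so a wire configuration amounts to a pair of half configurations,
  its restriction to the edges touching \<open>P\<close> and the restriction of its mirror image, and two
  half configurations fit together exactly if they have the same numbers and colours of links on
  the crossing edges (\<open>bij_betw_half_flip\<close>). A half configuration is again a wire configuration, on
  a graph some of whose edges have just one endpoint among the vertices. All data entering the
  weight are attached to single vertices or edges, so the weight is the product of the values of one
  function at the two halves (\<open>path_weight_factorizes\<close>), and so is the indicator of the event that the unpaired 1-links sit at \<open>x\<close>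
  and \<open>\<theta> y\<close> (\<open>two_point_event_factorizes\<close>). Once the configuration on the crossing edges is fixed,
  the two halves vary independently over the same set, and their sum is a square
  (\<open>infsum_fibre_product_nonneg\<close>).
\<close>

section \<open>Sums over fibre products\<close>

text \<open>
  A fibre product is the disjoint union of the squares of its fibres, and on the square of one
  fibre the sum of \<open>F x * F y\<close> is the square of the sum of \<open>F\<close>.
\<close>

lemma infsum_fibre_product_nonneg:
  fixes F :: "'a \<Rightarrow> real"
  assumes bij: "bij_betw (\<lambda>w. (p w, q w)) W {(x, y) \<in> H \<times> H. r x = r y}"
    and sum: "(\<lambda>w. F (p w) * F (q w)) summable_on W"
  shows "0 \<le> (\<Sum>\<^sub>\<infinity>w\<in>W. F (p w) * F (q w))"
proof -
  define B where "B k = {x \<in> H. r x = k}" for k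
  define S where "S = Sigma (r ` H) (\<lambda>k. B k \<times> B k)"
  define G where "G = (\<lambda>(k :: 'c, x, y). F x * F y)"
  have bij': "bij_betw (\<lambda>w. (r (p w), p w, q w)) W S"
  proof -
    have "bij_betw (\<lambda>(x, y). (r x, x, y)) {(x, y) \<in> H \<times> H. r x = r y} S"
      by (rule bij_betw_byWitness[where f' = snd]) (auto simp: S_def B_def)
    from bij_betw_trans[OF bij this] show ?thesis by (simp add: o_def)
  qed
  have sumG: "G summable_on S"
    using summable_on_reindex_bij_betw[OF bij', of G] sum by (simp add: G_def)
  have "(\<Sum>\<^sub>\<infinity>w\<in>W. F (p w) * F (q w)) = infsum G S"
    using infsum_reindex_bij_betw[OF bij', of G] by (simp add: G_def)
  also have "\<dots> = (\<Sum>\<^sub>\<infinity>k\<in>r ` H. \<Sum>\<^sub>\<infinity>z\<in>B k \<times> B k. G (k, z))"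
    using infsum_Sigma_banach[of G "r ` H" "\<lambda>k. B k \<times> B k"] sumG by (simp add: S_def)
  also have "\<dots> \<ge> 0"
  proof (rule infsum_nonneg)
    fix k assume k: "k \<in> r ` H"
    have "(\<lambda>z. G (k, z)) summable_on B k \<times> B k"
      using summable_on_SigmaD1[of "\<lambda>k z. G (k, z)" "r ` H" "\<lambda>k. B k \<times> B k" k] sumG k
      by (simp add: S_def)
    then have "(\<Sum>\<^sub>\<infinity>z\<in>B k \<times> B k. G (k, z)) = (\<Sum>\<^sub>\<infinity>x\<in>B k. \<Sum>\<^sub>\<infinity>y\<in>B k. F x * F y)"
      by (subst infsum_Sigma_banach[symmetric]) (simp_all add: G_def)
    also have "\<dots> = (infsum F (B k))\<^sup>2"
      by (simp add: infsum_cmult_left' infsum_cmult_right' power2_eq_square)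
    finally show "0 \<le> (\<Sum>\<^sub>\<infinity>z\<in>B k \<times> B k. G (k, z))" by simp
  qed
  finally show ?thesis .
qed

lemma has_sum_finite_sum:
  fixes f :: "'i \<Rightarrow> 'a \<Rightarrow> real"
  assumes "finite I" and "\<And>i. i \<in> I \<Longrightarrow> (f i has_sum s i) A"
  shows "((\<lambda>x. \<Sum>i\<in>I. f i x) has_sum (\<Sum>i\<in>I. s i)) A"
  using assms by (induction I rule: finite_induct) (auto intro: has_sum_add)

section \<open>Local data of wire configurations under relabelling of edges\<close>

abbreviation relabel :: "('v set \<Rightarrow> 'v set) \<Rightarrow> 'v link \<Rightarrow> 'v link" where
  "relabel f \<equiv> map_prod f id"

lemma inj_relabel: "inj f \<Longrightarrow> inj (relabel f)"
  by (simp add: prod.inj_map)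

text \<open>
  The vertex \<open>x'\<close> sees in \<open>w'\<close> what \<open>x\<close> sees in \<open>w\<close>, the edges being renamed by \<open>f\<close>. Two cases occur
  below: \<open>f = id\<close> when a configuration is restricted to the edges near \<open>x\<close>, and the action of the
  reflection on edges when it is mirrored. The number \<open>p\<close> of a link is kept in both, which is
  what preserves the relation of lying on the same edge.
\<close>

definition local_copy ::
    "('v set \<Rightarrow> 'v set) \<Rightarrow> 'v set set \<Rightarrow> 'v \<Rightarrow> 'v wire \<Rightarrow> 'v set set \<Rightarrow> 'v \<Rightarrow> 'v wire \<Rightarrow> bool" where
  "local_copy f E x w E' x' w' \<longleftrightarrow> (case w of (m, c, \<pi>) \<Rightarrow> case w' of (m', c', \<pi>') \<Rightarrow>
     inj f \<and> links_at E' m' x' = relabel f ` links_at E m x \<and>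
     (\<forall>l \<in> links_at E m x. c' (f (fst l)) (snd l) = c (fst l) (snd l)) \<and>
     \<pi>' x' = image (relabel f) ` \<pi> x)"

text \<open>
  The following four lemmas replace patterns \<open>(e, p)\<close> by a single variable for a link, so that
  images under \<open>relabel f\<close> can be treated by general facts about injections.
\<close>

lemma num_unpaired_eq:
  "num_unpaired E i x (m, c, \<pi>) =
     card {l \<in> links_at E m x. c (fst l) (snd l) = i \<and> l \<notin> \<Union> (\<pi> x)}"
  unfolding num_unpaired_def prod.case by (rule arg_cong[where f = card]) auto

lemma num_paired_eq:
  "num_paired E i x (m, c, \<pi>) =
     card {l \<in> links_at E m x. c (fst l) (snd l) = i \<and> l \<in> \<Union> (\<pi> x)}"
  unfolding num_paired_def prod.case by (rule arg_cong[where f = card]) auto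

lemma num_same_edge_eq:
  "num_same_edge E x (m, c, \<pi>) =
     card {l \<in> links_at E m x. \<exists>q. q \<noteq> snd l \<and> {l, (fst l, q)} \<in> \<pi> x}"
  unfolding num_same_edge_def prod.case by (rule arg_cong[where f = card]) auto

lemma pairings_at_iff:
  "P \<in> pairings_at E m c x \<longleftrightarrow> disjoint P \<and>
     (\<forall>A\<in>P. \<exists>k\<in>links_at E m x. \<exists>l\<in>links_at E m x.
        A = {k, l} \<and> k \<noteq> l \<and> c (fst k) (snd k) = c (fst l) (snd l))"
  unfolding pairings_at_def by fastforce

lemma card_filter_image:
  assumes "inj g" and "\<And>l. l \<in> A \<Longrightarrow> Q (g l) \<longleftrightarrow> R l"
  shows "card {l \<in> g ` A. Q l} = card {l \<in> A. R l}"
proof -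
  have "{l \<in> g ` A. Q l} = g ` {l \<in> A. R l}" using assms(2) by auto
  then show ?thesis using assms(1) by (metis card_image inj_on_subset subset_UNIV)
qed

lemma inj_image_mem_image_iff: "inj g \<Longrightarrow> g ` A \<in> image g ` \<A> \<longleftrightarrow> A \<in> \<A>"
  by (auto simp: inj_image_eq_iff)

lemma Union_image_image: "\<Union> (image g ` \<A>) = g ` \<Union> \<A>"
  by auto

lemma
  assumes "local_copy f E x w E' x' w'"
  shows local_copy_num_unpaired: "num_unpaired E' i x' w' = num_unpaired E i x w"
    and local_copy_num_paired: "num_paired E' i x' w' = num_paired E i x w"
    and local_copy_num_same_edge: "num_same_edge E' x' w' = num_same_edge E x w"
proof -
  obtain m c \<pi> m' c' \<pi>' where w: "w = (m, c, \<pi>)" "w' = (m', c', \<pi>')" by (metis prod_cases3)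
  have f: "inj f" and l: "links_at E' m' x' = relabel f ` links_at E m x"
    and c: "\<And>l. l \<in> links_at E m x \<Longrightarrow> c' (f (fst l)) (snd l) = c (fst l) (snd l)"
    and pi: "\<pi>' x' = image (relabel f) ` \<pi> x"
    using assms by (auto simp: local_copy_def w)
  note inj = inj_relabel[OF f]
  show "num_unpaired E' i x' w' = num_unpaired E i x w"
    unfolding w num_unpaired_eq l pi Union_image_image
    by (rule card_filter_image[OF inj]) (simp add: inj_image_mem_iff[OF inj] c)
  show "num_paired E' i x' w' = num_paired E i x w"
    unfolding w num_paired_eq l pi Union_image_image
    by (rule card_filter_image[OF inj]) (simp add: inj_image_mem_iff[OF inj] c)
  have same: "{relabel f l, (f (fst l), q)} \<in> \<pi>' x' \<longleftrightarrow> {l, (fst l, q)} \<in> \<pi> x" for l q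
  proof -
    have "{relabel f l, (f (fst l), q)} = relabel f ` {l, (fst l, q)}" by simp
    then show ?thesis unfolding pi by (simp only: inj_image_mem_image_iff[OF inj])
  qed
  show "num_same_edge E' x' w' = num_same_edge E x w"
    unfolding w num_same_edge_eq l
    by (rule card_filter_image[OF inj]) (simp add: same)
qed

lemma local_copy_vertex_weight:
  assumes "local_copy f E x w E' x' w'"
  shows "vertex_weight E' N U x' w' = vertex_weight E N U x w"
  by (simp add: vertex_weight_def local_time_def local_copy_num_unpaired[OF assms]
      local_copy_num_paired[OF assms] local_copy_num_same_edge[OF assms])

lemma local_copy_pairings_at:
  assumes copy: "local_copy f E x w E' x' w'"
    and pairing: "snd (snd w) x \<in> pairings_at E (fst w) (fst (snd w)) x"
  shows "snd (snd w') x' \<in> pairings_at E' (fst w') (fst (snd w')) x'"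
proof -
  obtain m c \<pi> m' c' \<pi>' where w: "w = (m, c, \<pi>)" "w' = (m', c', \<pi>')" by (metis prod_cases3)
  have f: "inj f" and l: "links_at E' m' x' = relabel f ` links_at E m x"
    and c: "\<And>l. l \<in> links_at E m x \<Longrightarrow> c' (f (fst l)) (snd l) = c (fst l) (snd l)"
    and pi: "\<pi>' x' = image (relabel f) ` \<pi> x"
    using copy by (auto simp: local_copy_def w)
  have P: "\<pi> x \<in> pairings_at E m c x" using pairing by (simp add: w)
  note inj = inj_relabel[OF f]
  have "disjoint (\<pi>' x')"
    unfolding pi using P inj
    by (intro disjoint_image) (auto simp: pairings_at_iff intro: inj_on_subset)
  moreover have "\<exists>k\<in>links_at E' m' x'. \<exists>l\<in>links_at E' m' x'. A = {k, l} \<and> k \<noteq> l \<and>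
      c' (fst k) (snd k) = c' (fst l) (snd l)" if A: "A \<in> \<pi>' x'" for A
  proof -
    from A obtain B where B: "B \<in> \<pi> x" "A = relabel f ` B" by (auto simp: pi)
    with P obtain k j where kj: "k \<in> links_at E m x" "j \<in> links_at E m x"
        "B = {k, j}" "k \<noteq> j" "c (fst k) (snd k) = c (fst j) (snd j)"
      unfolding pairings_at_iff by blast
    have "relabel f k \<noteq> relabel f j" using kj(4) inj by (simp add: inj_eq)
    then show ?thesis
      using kj B c by (intro bexI[of _ "relabel f k"] bexI[of _ "relabel f j"]) (auto simp: l)
  qed
  ultimately show ?thesis by (simp add: pairings_at_iff w)
qed

section \<open>Cutting a wire configuration along a reflection\<close>

text \<open>
  The edges in the last assumption are those with one endpoint in \<open>P\<close> and one outside. That they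
  are fixed as sets is the property of reflections through edges which makes both halves share the
  links on crossing edges without any renaming. The involution acts on the whole vertex type, so
  that it may be applied to arbitrary sets of vertices.
\<close>

locale reflection_graph =
  fixes V :: "'v set" and E :: "'v set set" and \<theta> :: "'v \<Rightarrow> 'v" and P :: "'v set"
  assumes finite_V: "finite V"
    and edge_subset: "e \<in> E \<Longrightarrow> e \<subseteq> V" and edge_nonempty: "e \<in> E \<Longrightarrow> e \<noteq> {}"
    and involution [simp]: "\<theta> (\<theta> x) = x"
    and reflect_V: "x \<in> V \<Longrightarrow> \<theta> x \<in> V" and reflect_E: "e \<in> E \<Longrightarrow> \<theta> ` e \<in> E"
    and half_subset: "P \<subseteq> V"
    and reflect_half: "x \<in> V \<Longrightarrow> \<theta> x \<in> P \<longleftrightarrow> x \<notin> P"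
    and crossing_edge: "e \<in> E \<Longrightarrow> \<not> e \<subseteq> P \<Longrightarrow> e \<inter> P \<noteq> {} \<Longrightarrow> \<theta> ` e = e"
begin

definition half_edges :: "'v set set" where
  "half_edges = {e \<in> E. e \<inter> P \<noteq> {}}"

definition crossing_edges :: "'v set set" where
  "crossing_edges = {e \<in> E. \<theta> ` e = e}"

text \<open>
  Only the pairing has to be restricted explicitly: preimages of non-edges under \<open>\<theta>\<close> are non-edges,
  where extensional families take the default value already.
\<close>

definition flip :: "'v wire \<Rightarrow> 'v wire" where
  "flip w = (case w of (m, c, \<pi>) \<Rightarrow>
     (\<lambda>e. m (\<theta> ` e), \<lambda>e. c (\<theta> ` e), \<lambda>x\<in>V. image (relabel (image \<theta>)) ` \<pi> (\<theta> x)))"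

text \<open>
  The edges of a half include the crossing edges, whose links may be paired at their endpoints in
  \<open>P\<close>; pairings are kept at the vertices of \<open>P\<close> only.
\<close>

definition half :: "'v wire \<Rightarrow> 'v wire" where
  "half w = (case w of (m, c, \<pi>) \<Rightarrow>
     (restrict m half_edges, restrict c half_edges, restrict \<pi> P))"

definition boundary :: "'v wire \<Rightarrow> ('v set \<Rightarrow> nat) \<times> ('v set \<Rightarrow> nat \<Rightarrow> nat)" where
  "boundary w = (case w of (m, c, \<pi>) \<Rightarrow> (restrict m crossing_edges, restrict c crossing_edges))"

text \<open>
  The inverse of \<open>w \<mapsto> (half w, half (flip w))\<close>. On a crossing edge the two arguments are meant to
  agree, so giving precedence to the first one is harmless.
\<close>

definition glue :: "'v wire \<Rightarrow> 'v wire \<Rightarrow> 'v wire" where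
  "glue w w' = (case w of (m, c, \<pi>) \<Rightarrow> case w' of (m', c', \<pi>') \<Rightarrow>
     (\<lambda>e. if e \<in> half_edges then m e else m' (\<theta> ` e),
      \<lambda>e. if e \<in> half_edges then c e else c' (\<theta> ` e),
      \<lambda>x\<in>V. if x \<in> P then \<pi> x else image (relabel (image \<theta>)) ` \<pi>' (\<theta> x)))"

lemma image_involution [simp]: "\<theta> ` \<theta> ` e = e"
  by (simp add: image_image)

lemma involution_eq_iff: "\<theta> x = \<theta> y \<longleftrightarrow> x = y"
  by (metis involution)

lemma inj_reflect: "inj \<theta>"
  by (metis injI involution)

lemma inj_image_reflect: "inj (image \<theta>)"
  by (metis injI image_involution)

lemma image_in_E_iff: "\<theta> ` e \<in> E \<longleftrightarrow> e \<in> E"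
  using reflect_E image_involution by metis

lemma mem_image_reflect: "x \<in> \<theta> ` e \<longleftrightarrow> \<theta> x \<in> e"
  by (metis image_eqI image_iff involution)

lemma relabel_involution [simp]: "relabel (image \<theta>) (relabel (image \<theta>) l) = l"
  by (simp add: map_prod_def case_prod_beta)

lemma image_relabel_involution [simp]:
  "image (relabel (image \<theta>)) ` image (relabel (image \<theta>)) ` A = A"
  by (simp add: image_image)

lemma crossing_subset_half: "crossing_edges \<subseteq> half_edges"
proof
  fix e assume e: "e \<in> crossing_edges"
  then have eE: "e \<in> E" and fixed: "\<theta> ` e = e" by (auto simp: crossing_edges_def)
  obtain x where x: "x \<in> e" using edge_nonempty[OF eE] by auto
  then have "\<theta> x \<in> e" using fixed by auto
  then show "e \<in> half_edges"
    using x eE edge_subset[OF eE] reflect_half[of x] by (auto simp: half_edges_def)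
qed

text \<open>
  An edge that does not cross the plane lies in one half and its mirror image in the other. Hence
  reflection identifies the edges inside \<open>P\<close> with those outside, and \<open>E\<close> is the disjoint union
  of these two sets and the crossing edges.
\<close>

lemma half_edge_cases:
  assumes "e \<in> E"
  shows "e \<in> half_edges \<and> \<theta> ` e \<notin> half_edges \<or> e \<notin> half_edges \<and> \<theta> ` e \<in> half_edges \<or>
    e \<in> crossing_edges"
proof (cases "\<theta> ` e = e")
  case True then show ?thesis using assms by (simp add: crossing_edges_def)
next
  case False
  have E: "\<theta> ` e \<in> E" "e \<subseteq> V" "e \<noteq> {}"
    using assms reflect_E edge_subset edge_nonempty by auto
  have "e \<subseteq> P \<or> e \<inter> P = {}" using crossing_edge[OF assms] False by auto
  then show ?thesis
  proof
    assume "e \<subseteq> P"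
    then have "\<theta> ` e \<inter> P = {}" using reflect_half E by fastforce
    with \<open>e \<subseteq> P\<close> E assms show ?thesis by (auto simp: half_edges_def)
  next
    assume 1: "e \<inter> P = {}"
    then have "\<theta> ` e \<subseteq> P" using reflect_half E by fastforce
    then have "\<theta> ` e \<inter> P \<noteq> {}" using E(3) by (simp add: Int_absorb2)
    with 1 E(1) show ?thesis by (simp add: half_edges_def)
  qed
qed

lemma local_copy_flip:
  assumes "x \<in> V"
  shows "local_copy (image \<theta>) E (\<theta> x) w E x (flip w)"
proof -
  obtain m c \<pi> where w: "w = (m, c, \<pi>)" by (metis prod_cases3)
  have "links_at E (\<lambda>e. m (\<theta> ` e)) x = relabel (image \<theta>) ` links_at E m (\<theta> x)"
  proof (intro set_eqI iffI)
    fix l assume "l \<in> links_at E (\<lambda>e. m (\<theta> ` e)) x"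
    then have "relabel (image \<theta>) l \<in> links_at E m (\<theta> x)"
      by (auto simp: links_at_def image_in_E_iff)
    then show "l \<in> relabel (image \<theta>) ` links_at E m (\<theta> x)"
      by (rule rev_image_eqI) (simp add: map_prod_def case_prod_beta)
  qed (auto simp: links_at_def image_in_E_iff mem_image_reflect)
  then show ?thesis using assms by (simp add: local_copy_def flip_def w inj_image_reflect)
qed

lemma flip_wires:
  assumes "w \<in> wires V E N"
  shows "flip w \<in> wires V E N"
proof -
  obtain m c \<pi> where w: "w = (m, c, \<pi>)" by (metis prod_cases3)
  have m: "m \<in> link_configs E" and c: "c \<in> colourings E N m" and p: "\<pi> \<in> pairings V E m c"
    using assms by (auto simp: wires_def w)
  obtain m' c' \<pi>' where w': "flip w = (m', c', \<pi>')" by (metis prod_cases3)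
  have def: "m' = (\<lambda>e. m (\<theta> ` e))" "c' = (\<lambda>e. c (\<theta> ` e))"
    "\<pi>' = (\<lambda>x\<in>V. image (relabel (image \<theta>)) ` \<pi> (\<theta> x))"
    using w' by (auto simp: flip_def w)
  have "m' \<in> link_configs E"
    using m by (auto simp: link_configs_def def PiE_def extensional_def image_in_E_iff)
  moreover have "c' \<in> colourings E N m'"
    using c by (simp add: colourings_def def PiE_iff extensional_def image_in_E_iff)
  moreover have "\<pi>' \<in> pairings V E m' c'"
    unfolding pairings_def
  proof (rule PiE_I)
    fix x assume x: "x \<in> V"
    have "\<pi> (\<theta> x) \<in> pairings_at E m c (\<theta> x)"
      using p reflect_V[OF x] by (auto simp: pairings_def)
    then show "\<pi>' x \<in> pairings_at E m' c' x"
      using local_copy_pairings_at[OF local_copy_flip[OF x, of w]] w' by (simp add: w)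
  qed (simp add: def)
  ultimately show ?thesis by (simp add: wires_def w')
qed

lemma flip_flip:
  assumes "w \<in> wires V E N"
  shows "flip (flip w) = w"
proof -
  obtain m c \<pi> where w: "w = (m, c, \<pi>)" by (metis prod_cases3)
  have "\<pi> \<in> extensional V" using assms by (auto simp: wires_def w pairings_def PiE_def)
  then show ?thesis
    by (auto simp: flip_def w restrict_def fun_eq_iff extensional_def reflect_V)
qed

lemma local_copy_half:
  assumes "x \<in> P"
  shows "local_copy id E x w half_edges x (half w)"
proof -
  obtain m c \<pi> where w: "w = (m, c, \<pi>)" by (metis prod_cases3)
  have "links_at half_edges (restrict m half_edges) x = links_at E m x"
    using assms by (auto simp: links_at_def half_edges_def split: if_splits)
  moreover have "fst l \<in> half_edges" if "l \<in> links_at E m x" for l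
    using that assms by (auto simp: links_at_def half_edges_def)
  ultimately show ?thesis using assms by (simp add: local_copy_def half_def w map_prod.id)
qed

lemma half_wires:
  assumes "w \<in> wires V E N"
  shows "half w \<in> wires P half_edges N"
proof -
  obtain m c \<pi> where w: "w = (m, c, \<pi>)" by (metis prod_cases3)
  have c: "c \<in> colourings E N m" and p: "\<pi> \<in> pairings V E m c"
    using assms by (auto simp: wires_def w)
  have "restrict c half_edges \<in> colourings half_edges N (restrict m half_edges)"
    using c by (auto simp: colourings_def PiE_iff half_edges_def)
  moreover have "restrict \<pi> P \<in> pairings P half_edges (restrict m half_edges) (restrict c half_edges)"
    unfolding pairings_def
  proof (rule PiE_I)
    fix x assume x: "x \<in> P"
    have "\<pi> x \<in> pairings_at E m c x" using p x half_subset by (auto simp: pairings_def)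
    then show "restrict \<pi> P x \<in> pairings_at half_edges (restrict m half_edges) (restrict c half_edges) x"
      using local_copy_pairings_at[OF local_copy_half[OF x, of w]] x by (simp add: half_def w)
  qed simp
  ultimately show ?thesis by (simp add: wires_def half_def w link_configs_def)
qed

text \<open>
  Gluing is symmetric up to reflection. This reduces every statement about a glued configuration
  on the far side of the plane to the corresponding statement on \<open>P\<close>.
\<close>

lemma flip_glue:
  assumes "w \<in> wires P half_edges N" "w' \<in> wires P half_edges N" "boundary w = boundary w'"
  shows "flip (glue w w') = glue w' w"
proof -
  obtain m c \<pi> where w: "w = (m, c, \<pi>)" by (metis prod_cases3)
  obtain m' c' \<pi>' where w': "w' = (m', c', \<pi>')" by (metis prod_cases3)
  have ext: "m \<in> extensional half_edges" "m' \<in> extensional half_edges"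
      "c \<in> extensional half_edges" "c' \<in> extensional half_edges"
    using assms by (auto simp: wires_def w w' link_configs_def colourings_def PiE_def)
  have agree: "m e = m' e" "c e = c' e" "\<theta> ` e = e" if "e \<in> crossing_edges" for e
  proof -
    have "restrict m crossing_edges e = restrict m' crossing_edges e"
      "restrict c crossing_edges e = restrict c' crossing_edges e"
      using assms(3) by (simp_all add: boundary_def w w')
    then show "m e = m' e" "c e = c' e" using that by simp_all
    show "\<theta> ` e = e" using that by (simp add: crossing_edges_def)
  qed
  have side: "e \<notin> half_edges \<and> \<theta> ` e \<notin> half_edges" if "e \<notin> E" for e
    using that image_in_E_iff by (auto simp: half_edges_def)
  have "(\<lambda>e. if \<theta> ` e \<in> half_edges then m (\<theta> ` e) else m' e) =
        (\<lambda>e. if e \<in> half_edges then m' e else m (\<theta> ` e))" (is "?m = ?m'")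
  proof
    fix e show "?m e = ?m' e"
      using half_edge_cases[of e] side[of e] agree[of e] ext crossing_subset_half
      by (cases "e \<in> E") (auto simp: extensional_def)
  qed
  moreover have "(\<lambda>e. if \<theta> ` e \<in> half_edges then c (\<theta> ` e) else c' e) =
        (\<lambda>e. if e \<in> half_edges then c' e else c (\<theta> ` e))" (is "?c = ?c'")
  proof
    fix e show "?c e = ?c' e"
      using half_edge_cases[of e] side[of e] agree[of e] ext crossing_subset_half
      by (cases "e \<in> E") (auto simp: extensional_def)
  qed
  moreover have "(\<lambda>x\<in>V. image (relabel (image \<theta>)) `
        (\<lambda>x\<in>V. if x \<in> P then \<pi> x else image (relabel (image \<theta>)) ` \<pi>' (\<theta> x)) (\<theta> x)) =
      (\<lambda>x\<in>V. if x \<in> P then \<pi>' x else image (relabel (image \<theta>)) ` \<pi> (\<theta> x))"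
    by (rule restrict_ext) (auto simp: reflect_V reflect_half)
  ultimately show ?thesis
    by (simp only: flip_def glue_def w w' prod.case image_involution)
qed

lemma half_glue:
  assumes "w \<in> wires P half_edges N"
  shows "half (glue w w') = w"
proof -
  obtain m c \<pi> where w: "w = (m, c, \<pi>)" by (metis prod_cases3)
  obtain m' c' \<pi>' where w': "w' = (m', c', \<pi>')" by (metis prod_cases3)
  have ext: "m \<in> extensional half_edges" "c \<in> extensional half_edges" "\<pi> \<in> extensional P"
    using assms by (auto simp: wires_def w link_configs_def colourings_def pairings_def PiE_def)
  have "restrict (\<lambda>e. if e \<in> half_edges then m e else m' (\<theta> ` e)) half_edges = m"
    "restrict (\<lambda>e. if e \<in> half_edges then c e else c' (\<theta> ` e)) half_edges = c"
    using ext by (auto simp: restrict_def extensional_def)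
  then show ?thesis
    using half_subset ext by (auto simp: half_def glue_def w w' fun_eq_iff restrict_def extensional_def)
qed

lemma glue_half:
  assumes "w \<in> wires V E N"
  shows "glue (half w) (half (flip w)) = w"
proof -
  obtain m c \<pi> where w: "w = (m, c, \<pi>)" by (metis prod_cases3)
  have ext: "m \<in> extensional E" "c \<in> extensional E" "\<pi> \<in> extensional V"
    using assms by (auto simp: wires_def w link_configs_def colourings_def pairings_def PiE_def)
  have side: "e \<in> half_edges \<or> \<theta> ` e \<in> half_edges \<or> e \<notin> E" for e
    using half_edge_cases[of e] crossing_subset_half by auto
  have out: "\<theta> ` e \<notin> half_edges" if "e \<notin> E" for e
    using that image_in_E_iff by (auto simp: half_edges_def)
  have "(\<lambda>e. if e \<in> half_edges then restrict m half_edges e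
         else restrict (\<lambda>e. m (\<theta> ` e)) half_edges (\<theta> ` e)) = m" (is "?m = m")
  proof
    fix e show "?m e = m e"
      using side[of e] out[of e] ext by (cases "e \<in> E") (auto simp: extensional_def half_edges_def)
  qed
  moreover have "(\<lambda>e. if e \<in> half_edges then restrict c half_edges e
         else restrict (\<lambda>e. c (\<theta> ` e)) half_edges (\<theta> ` e)) = c" (is "?c = c")
  proof
    fix e show "?c e = c e"
      using side[of e] out[of e] ext by (cases "e \<in> E") (auto simp: extensional_def half_edges_def)
  qed
  moreover have "(\<lambda>x\<in>V. if x \<in> P then restrict \<pi> P x
      else image (relabel (image \<theta>)) ` restrict (\<lambda>x\<in>V. image (relabel (image \<theta>)) ` \<pi> (\<theta> x)) P (\<theta> x)) = \<pi>"
    (is "?p = \<pi>")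
  proof
    fix x show "?p x = \<pi> x"
      using ext reflect_V[of x] reflect_half[of x] by (cases "x \<in> V") (auto simp: extensional_def)
  qed
  ultimately show ?thesis by (simp only: half_def flip_def glue_def w prod.case)
qed

text \<open>
  A pairing of the glued configuration at a vertex of \<open>P\<close> is one of \<open>w\<close>, because a vertex of \<open>P\<close> only
  touches edges of the half; at other vertices \<open>flip_glue\<close> applies.
\<close>

lemma glue_wires:
  assumes "w \<in> wires P half_edges N" "w' \<in> wires P half_edges N" "boundary w = boundary w'"
  shows "glue w w' \<in> wires V E N"
proof -
  have m: "fst (glue v v') \<in> link_configs E" and c: "fst (snd (glue v v')) \<in> colourings E N (fst (glue v v'))"
    if v: "v \<in> wires P half_edges N" "v' \<in> wires P half_edges N" for v v'
  proof -
    obtain m c \<pi> where w: "v = (m, c, \<pi>)" by (metis prod_cases3)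
    obtain m' c' \<pi>' where w': "v' = (m', c', \<pi>')" by (metis prod_cases3)
    have side: "e \<in> half_edges \<or> \<theta> ` e \<in> half_edges \<or> e \<notin> E" for e
      using half_edge_cases[of e] crossing_subset_half by auto
    have out: "e \<notin> half_edges \<and> \<theta> ` e \<notin> half_edges" if "e \<notin> E" for e
      using that image_in_E_iff by (auto simp: half_edges_def)
    show "fst (glue v v') \<in> link_configs E"
      using v out by (auto simp: w w' glue_def wires_def link_configs_def PiE_def extensional_def)
    have c: "c \<in> colourings half_edges N m" "c' \<in> colourings half_edges N m'"
      using v by (auto simp: w w' wires_def)
    have cf: "c e \<in> {1..m e} \<rightarrow>\<^sub>E {1..N}" "c' e \<in> {1..m' e} \<rightarrow>\<^sub>E {1..N}" if "e \<in> half_edges" for e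
      using c that unfolding colourings_def by (auto dest: PiE_mem)
    have cu: "c' e = undefined" if "e \<notin> half_edges" for e
      using c that unfolding colourings_def by (auto dest: PiE_arb)
    show "fst (snd (glue v v')) \<in> colourings E N (fst (glue v v'))"
      unfolding colourings_def
    proof (rule PiE_I)
      fix e assume "e \<in> E"
      then show "fst (snd (glue v v')) e \<in> {1..fst (glue v v') e} \<rightarrow>\<^sub>E {1..N}"
        using side[of e] cf(1)[of e] cf(2)[of "\<theta> ` e"] by (auto simp: w w' glue_def)
    qed (use out cu in \<open>auto simp: w w' glue_def\<close>)
  qed
  have near: "snd (snd (glue v v')) x \<in> pairings_at E (fst (glue v v')) (fst (snd (glue v v'))) x"
    if v: "v \<in> wires P half_edges N" and x: "x \<in> P" for v v' x
  proof -
    obtain m c \<pi> where w: "v = (m, c, \<pi>)" by (metis prod_cases3)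
    have "local_copy id half_edges x v E x (glue v v')"
      using local_copy_half[OF x, of "glue v v'"] half_glue[OF v, of v']
      by (auto simp: local_copy_def map_prod.id split: prod.splits)
    moreover have "\<pi> x \<in> pairings_at half_edges m c x"
      using v x by (auto simp: w wires_def pairings_def)
    ultimately show ?thesis using local_copy_pairings_at by (metis w fst_conv snd_conv)
  qed
  have "snd (snd (glue w w')) x \<in> pairings_at E (fst (glue w w')) (fst (snd (glue w w'))) x"
    if x: "x \<in> V" for x
  proof (cases "x \<in> P")
    case False
    then have "\<theta> x \<in> P" using reflect_half x by auto
    from local_copy_pairings_at[OF local_copy_flip[OF x] near[OF assms(2) this, of w]]
    show ?thesis by (simp only: flip_glue[OF assms(2,1) assms(3)[symmetric]])
  qed (use near assms in auto)
  then have "snd (snd (glue w w')) \<in> pairings V E (fst (glue w w')) (fst (snd (glue w w')))"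
    by (auto simp: pairings_def PiE_iff glue_def split: prod.splits)
  with m[OF assms(1,2)] c[OF assms(1,2)] show ?thesis
    by (simp add: wires_def case_prod_beta)
qed

lemma boundary_half: "boundary (half w) = boundary w"
  using crossing_subset_half
  by (auto simp: boundary_def half_def fun_eq_iff restrict_def split: prod.splits)

lemma boundary_flip: "boundary (flip w) = boundary w"
  by (auto simp: boundary_def flip_def fun_eq_iff restrict_def crossing_edges_def split: prod.splits)

lemma bij_betw_half_flip:
  "bij_betw (\<lambda>w. (half w, half (flip w))) (wires V E N)
     {(w, w') \<in> wires P half_edges N \<times> wires P half_edges N. boundary w = boundary w'}"
proof (rule bij_betw_byWitness[where f' = "\<lambda>(w, w'). glue w w'"])
  show "(\<lambda>w. (half w, half (flip w))) ` wires V E N \<subseteq>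
      {(w, w') \<in> wires P half_edges N \<times> wires P half_edges N. boundary w = boundary w'}"
    by (auto simp: half_wires flip_wires boundary_half boundary_flip)
qed (auto simp: glue_half half_glue flip_glue glue_wires)

section \<open>Reflection positivity of the two-point function\<close>

lemma finite_E: "finite E"
  by (rule finite_subset[of _ "Pow V"]) (use edge_subset finite_V in auto)

lemma finite_half [simp]: "finite P"
  using half_subset finite_V by (rule finite_subset)

lemma prod_reflect_V: "(\<Prod>x\<in>V. f (\<theta> x)) = (\<Prod>x\<in>V. f x)"
  by (rule prod.reindex_bij_witness[of _ \<theta> \<theta>]) (auto simp: reflect_V)

lemma prod_reflect_E: "(\<Prod>e\<in>E. f (\<theta> ` e)) = (\<Prod>e\<in>E. f e)"
  by (rule prod.reindex_bij_witness[of _ "image \<theta>" "image \<theta>"]) (auto simp: reflect_E)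

lemma reflect_V_iff: "\<theta> x \<in> V \<longleftrightarrow> x \<in> V"
  using reflect_V[of x] reflect_V[of "\<theta> x"] by auto

lemma reflect_swap: "\<theta> x = y \<longleftrightarrow> x = \<theta> y"
  by auto

lemma V_split: "V = P \<union> \<theta> ` P" "P \<inter> \<theta> ` P = {}"
  using half_subset reflect_half reflect_V mem_image_reflect by blast+

lemma fst_flip: "fst (flip w) e = fst w (\<theta> ` e)"
  by (simp add: flip_def split: prod.splits)

lemma fst_half: "e \<in> half_edges \<Longrightarrow> fst (half w) e = fst w e"
  by (simp add: half_def split: prod.splits)

lemma path_weight_flip: "path_weight V E N \<beta> U (flip w) = path_weight V E N \<beta> U w"
proof -
  have "(\<Prod>x\<in>V. vertex_weight E N U x (flip w)) = (\<Prod>x\<in>V. vertex_weight E N U (\<theta> x) w)"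
    by (rule prod.cong[OF refl]) (rule local_copy_vertex_weight[OF local_copy_flip])
  also have "\<dots> = (\<Prod>x\<in>V. vertex_weight E N U x w)"
    by (rule prod_reflect_V)
  finally show ?thesis
    unfolding path_weight_def fst_flip
    by (simp only: prod_reflect_E[of "\<lambda>e. \<beta> ^ fst w e / fact (fst w e)"])
qed

text \<open>
  The weight of a crossing edge belongs to both halves. Giving its square root to each of them makes
  the total weight a product of two values of one and the same function.
\<close>

definition half_weight :: "nat \<Rightarrow> real \<Rightarrow> weight \<Rightarrow> 'v wire \<Rightarrow> real" where
  "half_weight N \<beta> U w =
     (\<Prod>e\<in>half_edges - crossing_edges. \<beta> ^ fst w e / fact (fst w e)) *
     sqrt (\<Prod>e\<in>crossing_edges. \<beta> ^ fst w e / fact (fst w e)) *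
     (\<Prod>x\<in>P. vertex_weight half_edges N U x w)"

lemma path_weight_factorizes:
  assumes "\<beta> \<ge> 0"
  shows "path_weight V E N \<beta> U w = half_weight N \<beta> U (half w) * half_weight N \<beta> U (half (flip w))"
proof -
  define f where "f e = \<beta> ^ fst w e / fact (fst w e)" for e
  let ?I = "half_edges - crossing_edges"
  have crossE: "e \<in> crossing_edges \<Longrightarrow> e \<in> half_edges \<and> \<theta> ` e = e" for e
    using crossing_subset_half by (auto simp: crossing_edges_def)
  have fin: "finite ?I" "finite crossing_edges"
    using finite_E by (simp_all add: half_edges_def crossing_edges_def)
  have E: "E = ?I \<union> (image \<theta> ` ?I \<union> crossing_edges)"
  proof (intro set_eqI iffI)
    fix e assume "e \<in> E"
    moreover have "e \<in> image \<theta> ` ?I" if "\<theta> ` e \<in> ?I"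
      using that by (rule rev_image_eqI) simp
    moreover have "\<theta> ` e \<notin> crossing_edges" if "e \<notin> crossing_edges"
      using that by (metis crossE image_involution)
    ultimately show "e \<in> ?I \<union> (image \<theta> ` ?I \<union> crossing_edges)"
      using half_edge_cases[of e] by auto
  qed (auto simp: half_edges_def crossing_edges_def reflect_E)
  have disj: "?I \<inter> (image \<theta> ` ?I \<union> crossing_edges) = {}" "image \<theta> ` ?I \<inter> crossing_edges = {}"
  proof -
    have "\<theta> ` e \<notin> half_edges" if "e \<in> ?I" for e
      using that half_edge_cases[of e] by (auto simp: half_edges_def)
    then show "?I \<inter> (image \<theta> ` ?I \<union> crossing_edges) = {}" "image \<theta> ` ?I \<inter> crossing_edges = {}"
      using crossing_subset_half by auto
  qed
  have "(\<Prod>e\<in>E. f e) = (\<Prod>e\<in>?I. f e) * ((\<Prod>e\<in>image \<theta> ` ?I. f e) * (\<Prod>e\<in>crossing_edges. f e))"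
    by (subst E) (use fin disj in \<open>simp add: prod.union_disjoint\<close>)
  also have "(\<Prod>e\<in>image \<theta> ` ?I. f e) = (\<Prod>e\<in>?I. f (\<theta> ` e))"
    by (rule prod.reindex_cong[OF inj_on_subset[OF inj_image_reflect]]) auto
  finally have edges: "(\<Prod>e\<in>E. f e) =
      (\<Prod>e\<in>?I. f e) * ((\<Prod>e\<in>?I. f (\<theta> ` e)) * (\<Prod>e\<in>crossing_edges. f e))" .
  have "(\<Prod>x\<in>V. vertex_weight E N U x w) =
      (\<Prod>x\<in>P. vertex_weight E N U x w) * (\<Prod>x\<in>\<theta> ` P. vertex_weight E N U x w)"
    using V_split by (metis finite_half finite_imageI prod.union_disjoint)
  also have "(\<Prod>x\<in>\<theta> ` P. vertex_weight E N U x w) = (\<Prod>x\<in>P. vertex_weight E N U (\<theta> x) w)"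
    by (rule prod.reindex_cong[OF inj_on_subset[OF inj_reflect]]) auto
  also have "\<dots> = (\<Prod>x\<in>P. vertex_weight half_edges N U x (half (flip w)))"
  proof (rule prod.cong[OF refl])
    fix x assume x: "x \<in> P"
    then have V: "x \<in> V" using half_subset by auto
    show "vertex_weight E N U (\<theta> x) w = vertex_weight half_edges N U x (half (flip w))"
      by (simp only: local_copy_vertex_weight[OF local_copy_half[OF x]]
          local_copy_vertex_weight[OF local_copy_flip[OF V]])
  qed
  also have "(\<Prod>x\<in>P. vertex_weight E N U x w) = (\<Prod>x\<in>P. vertex_weight half_edges N U x (half w))"
    by (rule prod.cong[OF refl]) (rule local_copy_vertex_weight[OF local_copy_half, symmetric])
  finally have sites: "(\<Prod>x\<in>V. vertex_weight E N U x w) =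
      (\<Prod>x\<in>P. vertex_weight half_edges N U x (half w)) *
      (\<Prod>x\<in>P. vertex_weight half_edges N U x (half (flip w)))" .
  define q where "q = (\<Prod>e\<in>crossing_edges. f e)"
  have "q \<ge> 0" unfolding q_def f_def by (intro prod_nonneg) (use assms in auto)
  then have q: "sqrt q * sqrt q = q" by simp
  have hw: "half_weight N \<beta> U (half w) =
      (\<Prod>e\<in>?I. f e) * sqrt q * (\<Prod>x\<in>P. vertex_weight half_edges N U x (half w))"
    unfolding half_weight_def q_def f_def using crossE by (simp add: fst_half)
  have hf: "half_weight N \<beta> U (half (flip w)) =
      (\<Prod>e\<in>?I. f (\<theta> ` e)) * sqrt q * (\<Prod>x\<in>P. vertex_weight half_edges N U x (half (flip w)))"
    unfolding half_weight_def q_def f_def using crossE by (simp add: fst_half fst_flip)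
  have "path_weight V E N \<beta> U w = (\<Prod>e\<in>?I. f e) * ((\<Prod>e\<in>?I. f (\<theta> ` e)) * (sqrt q * sqrt q)) *
      ((\<Prod>x\<in>P. vertex_weight half_edges N U x (half w)) *
      (\<Prod>x\<in>P. vertex_weight half_edges N U x (half (flip w))))"
    by (simp only: q path_weight_def f_def[symmetric] edges sites q_def[symmetric])
  also have "\<dots> = half_weight N \<beta> U (half w) * half_weight N \<beta> U (half (flip w))"
    unfolding hw hf by (simp only: mult_ac)
  finally show ?thesis .
qed

lemma summable_event:
  assumes "finite_mass V E N \<beta> U"
  shows "(\<lambda>w. of_bool (Q w) * path_weight V E N \<beta> U w) summable_on wires V E N"
proof -
  have "(\<lambda>w. path_weight V E N \<beta> U w) summable_on wires V E N"
    using assms by (simp add: finite_mass_def path_finite_def)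
  then have "(\<lambda>w. path_weight V E N \<beta> U w) abs_summable_on wires V E N"
    by (rule iffD1[OF summable_on_iff_abs_summable_on_real])
  then have "(\<lambda>w. of_bool (Q w) * path_weight V E N \<beta> U w) abs_summable_on wires V E N"
    by (rule abs_summable_on_comparison_test) auto
  then show ?thesis by (rule iffD2[OF summable_on_iff_abs_summable_on_real])
qed

lemma Z_two_point_reflect:
  assumes "x \<in> V" "y \<in> V"
  shows "Z_two_point V E N \<beta> U (\<theta> x) (\<theta> y) = Z_two_point V E N \<beta> U x y"
proof -
  have event: "two_point_event V E x y (flip w) \<longleftrightarrow> two_point_event V E (\<theta> x) (\<theta> y) w" for w
  proof -
    have u: "num_unpaired E 1 z (flip w) = num_unpaired E 1 (\<theta> z) w" if "z \<in> V" for z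
      by (rule local_copy_num_unpaired[OF local_copy_flip[OF that]])
    have "(\<forall>z\<in>V - {x, y}. num_unpaired E 1 (\<theta> z) w = 0) \<longleftrightarrow>
        (\<forall>z\<in>V - {\<theta> x, \<theta> y}. num_unpaired E 1 z w = 0)"
    proof -
      have "V - {\<theta> x, \<theta> y} = \<theta> ` (V - {x, y})"
        by (rule set_eqI) (simp add: mem_image_reflect reflect_V_iff reflect_swap)
      then show ?thesis by simp
    qed
        then show ?thesis using assms
      by (cases "x = y") (simp_all add: two_point_event_def u involution_eq_iff del: One_nat_def)
  qed
  have bij: "bij_betw flip (wires V E N) (wires V E N)"
    by (rule bij_betw_byWitness[where f' = flip]) (auto simp: flip_wires flip_flip)
  show ?thesis
    unfolding Z_two_point_def path_sum_def
    by (subst (2) infsum_reindex_bij_betw[OF bij, symmetric]) (simp add: event path_weight_flip)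
qed

definition half_event :: "'v \<Rightarrow> 'v wire \<Rightarrow> bool" where
  "half_event x w \<longleftrightarrow> num_unpaired half_edges 1 x w = 1 \<and>
     (\<forall>z\<in>P - {x}. num_unpaired half_edges 1 z w = 0)"

text \<open>
  The endpoints \<open>x\<close> and \<open>\<theta> y\<close> lie in opposite halves, so the requirements at the vertices of \<open>P\<close> and
  at the others are separate, and those outside \<open>P\<close> concern the mirror image.
\<close>

lemma two_point_event_factorizes:
  assumes "x \<in> P" "y \<in> P"
  shows "two_point_event V E x (\<theta> y) w \<longleftrightarrow> half_event x (half w) \<and> half_event y (half (flip w))"
proof -
  have u: "num_unpaired half_edges 1 z (half w) = num_unpaired E 1 z w"
    "num_unpaired half_edges 1 z (half (flip w)) = num_unpaired E 1 (\<theta> z) w" if "z \<in> P" for z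
  proof -
    have V: "z \<in> V" using that half_subset by auto
    show "num_unpaired half_edges 1 z (half w) = num_unpaired E 1 z w"
      by (rule local_copy_num_unpaired[OF local_copy_half[OF that]])
    show "num_unpaired half_edges 1 z (half (flip w)) = num_unpaired E 1 (\<theta> z) w"
      by (simp only: local_copy_num_unpaired[OF local_copy_half[OF that]]
          local_copy_num_unpaired[OF local_copy_flip[OF V]])
  qed
  have neq: "x \<noteq> \<theta> y" using assms half_subset reflect_half by auto
  have "V - {x, \<theta> y} = (P - {x}) \<union> \<theta> ` (P - {y})"
  proof (rule set_eqI)
    fix z
    show "z \<in> V - {x, \<theta> y} \<longleftrightarrow> z \<in> (P - {x}) \<union> \<theta> ` (P - {y})"
      using assms half_subset reflect_half[of z] reflect_V_iff[of z]
      by (auto simp: mem_image_reflect reflect_swap)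
  qed
  then have "(\<forall>z\<in>V - {x, \<theta> y}. num_unpaired E 1 z w = 0) \<longleftrightarrow>
      (\<forall>z\<in>P - {x}. num_unpaired E 1 z w = 0) \<and> (\<forall>z\<in>P - {y}. num_unpaired E 1 (\<theta> z) w = 0)"
    by (simp add: ball_Un)
  then show ?thesis
    using assms neq by (auto simp: two_point_event_def half_event_def u simp del: One_nat_def)
qed

text \<open>
  Expanding the product of the two linear combinations below gives the claimed sum over pairs,
  while as a sum over configurations it is a sum over a fibre product.
\<close>

lemma reflection_positivity:
  assumes "\<beta> \<ge> 0" and mass: "finite_mass V E N \<beta> U"
  shows "0 \<le> (\<Sum>x\<in>P. \<Sum>y\<in>P. Z_two_point V E N \<beta> U x (\<theta> y) * g x * g y)"
proof -
  define F where "F w = half_weight N \<beta> U w * (\<Sum>x\<in>P. g x * of_bool (half_event x w))" for w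
  let ?t = "\<lambda>x y w. g x * g y * (of_bool (two_point_event V E x (\<theta> y) w) * path_weight V E N \<beta> U w)"
  have sum: "?t x y summable_on wires V E N" for x y
    by (intro summable_on_cmult_right summable_event mass)
  have F: "F (half w) * F (half (flip w)) = (\<Sum>x\<in>P. \<Sum>y\<in>P. ?t x y w)" for w
  proof -
    have "F (half w) * F (half (flip w)) = path_weight V E N \<beta> U w *
       ((\<Sum>x\<in>P. g x * of_bool (half_event x (half w))) * (\<Sum>y\<in>P. g y * of_bool (half_event y (half (flip w)))))"
      by (simp add: F_def path_weight_factorizes[OF assms(1)] mult_ac)
    also have "\<dots> = (\<Sum>x\<in>P. \<Sum>y\<in>P. ?t x y w)"
      unfolding sum_product
      unfolding sum_distrib_left
      by (intro sum.cong refl) (simp add: two_point_event_factorizes of_bool_conj)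
    finally show ?thesis .
  qed
  have "((\<lambda>w. \<Sum>x\<in>P. \<Sum>y\<in>P. ?t x y w) has_sum (\<Sum>x\<in>P. \<Sum>y\<in>P. infsum (?t x y) (wires V E N)))
      (wires V E N)"
    by (intro has_sum_finite_sum has_sum_infsum sum finite_half)
  then have *: "((\<lambda>w. F (half w) * F (half (flip w))) has_sum
      (\<Sum>x\<in>P. \<Sum>y\<in>P. infsum (?t x y) (wires V E N))) (wires V E N)"
    by (simp only: F)
  have "0 \<le> (\<Sum>\<^sub>\<infinity>w\<in>wires V E N. F (half w) * F (half (flip w)))"
    by (rule infsum_fibre_product_nonneg[OF bij_betw_half_flip])
       (use * in \<open>simp add: summable_on_def\<close>, blast)
  also have "\<dots> = (\<Sum>x\<in>P. \<Sum>y\<in>P. infsum (?t x y) (wires V E N))"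
    by (rule infsumI[OF *])
  also have "\<dots> = (\<Sum>x\<in>P. \<Sum>y\<in>P. Z_two_point V E N \<beta> U x (\<theta> y) * g x * g y)"
    by (simp add: infsum_cmult_right' Z_two_point_def path_sum_def mult_ac)
  finally show ?thesis .
qed

section \<open>The quadratic form of the two-point function\<close>

text \<open>
  The factor \<open>2\<close> in \<open>W\<close> absorbs the diagonal terms, which \<open>Z2\<close> counts with weight \<open>1\<close> instead of
  \<open>1 / 2\<close>, into a single double sum over ordered pairs. Reflection invariance then folds this sum to
  one over \<open>P\<close>. No pair \<open>(x, \<theta> y)\<close> is diagonal, so the coefficient of the mixed terms is \<open>Z\<close> itself.
\<close>

lemma Z2_half_form:
  fixes N \<beta> U
  defines "Z \<equiv> Z_two_point V E N \<beta> U"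
  defines "W \<equiv> \<lambda>x y. (if x = y then 2 else 1) * Z x y"
  shows "Z2 V E N \<beta> U h = 1 / 2 * (\<Sum>x\<in>P. \<Sum>y\<in>P.
    W x y * (h x * h y + h (\<theta> x) * h (\<theta> y)) + Z x (\<theta> y) * (h x * h (\<theta> y) + h (\<theta> x) * h y))"
proof -
  have split: "(\<Sum>x\<in>V. f x) = (\<Sum>x\<in>P. f x + f (\<theta> x))" for f :: "'v \<Rightarrow> real"
  proof -
    have "(\<Sum>x\<in>V. f x) = (\<Sum>x\<in>P. f x) + (\<Sum>x\<in>\<theta> ` P. f x)"
      using V_split by (metis finite_half finite_imageI sum.union_disjoint)
    also have "(\<Sum>x\<in>\<theta> ` P. f x) = (\<Sum>x\<in>P. f (\<theta> x))"
      by (rule sum.reindex_cong[OF inj_on_subset[OF inj_reflect]]) auto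
    finally show ?thesis by (simp add: sum.distrib)
  qed
  have "Z2 V E N \<beta> U h = 1 / 2 * (\<Sum>x\<in>V. \<Sum>y\<in>V. W x y * h x * h y)"
  proof -
    have "(\<Sum>y\<in>V. W x y * h x * h y) = 2 * (Z x x * (h x)\<^sup>2) + (\<Sum>y\<in>V - {x}. Z x y * h x * h y)"
      if "x \<in> V" for x
      by (subst sum.remove[OF finite_V that])
         (auto simp: W_def power2_eq_square intro!: sum.cong split: if_splits)
    then show ?thesis
      by (simp add: Z2_def Z_def[symmetric] sum.distrib sum_distrib_left[symmetric])
  qed
  also have "(\<Sum>x\<in>V. \<Sum>y\<in>V. W x y * h x * h y) =
      (\<Sum>x\<in>P. (\<Sum>y\<in>V. W x y * h x * h y) + (\<Sum>y\<in>V. W (\<theta> x) y * h (\<theta> x) * h y))"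
    by (rule split)
  also have "(\<Sum>x\<in>P. (\<Sum>y\<in>V. W x y * h x * h y) + (\<Sum>y\<in>V. W (\<theta> x) y * h (\<theta> x) * h y)) =
      (\<Sum>x\<in>P. \<Sum>y\<in>P. W x y * (h x * h y + h (\<theta> x) * h (\<theta> y)) +
        Z x (\<theta> y) * (h x * h (\<theta> y) + h (\<theta> x) * h y))"
    unfolding split sum.distrib[symmetric]
  proof (intro sum.cong refl)
    fix x y assume "x \<in> P" "y \<in> P"
    then have V: "x \<in> V" "y \<in> V" "x \<noteq> \<theta> y" "\<theta> x \<noteq> y" "\<theta> x = \<theta> y \<longleftrightarrow> x = y"
      using half_subset reflect_half involution_eq_iff by auto
    have "W (\<theta> x) (\<theta> y) = W x y" "W x (\<theta> y) = Z x (\<theta> y)" "W (\<theta> x) y = Z x (\<theta> y)"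
      using V Z_two_point_reflect[of x y N \<beta> U] Z_two_point_reflect[of x "\<theta> y" N \<beta> U] reflect_V
      by (auto simp: W_def Z_def)
    then show "W x y * h x * h y + W x (\<theta> y) * h x * h (\<theta> y) +
        (W (\<theta> x) y * h (\<theta> x) * h y + W (\<theta> x) (\<theta> y) * h (\<theta> x) * h (\<theta> y)) =
      W x y * (h x * h y + h (\<theta> x) * h (\<theta> y)) + Z x (\<theta> y) * (h x * h (\<theta> y) + h (\<theta> x) * h y)"
      by (simp add: algebra_simps)
  qed
  finally show ?thesis .
qed

text \<open>
  In \<open>h\<^sub>1\<close> and \<open>h\<^sub>2\<close> the values of \<open>h\<close> on one half are copied to the other. The terms with \<open>W\<close> cancel, and
  \<open>h x * h y + h (\<theta> x) * h (\<theta> y) - h x * h (\<theta> y) - h (\<theta> x) * h y\<close> is a product of differences.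
\<close>

theorem Z2_reflection_bound:
  assumes "\<beta> \<ge> 0" and "finite_mass V E N \<beta> U"
    and plus: "\<And>x. x \<in> P \<Longrightarrow> h\<^sub>1 x = h x \<and> h\<^sub>1 (\<theta> x) = h x"
    and minus: "\<And>x. x \<in> P \<Longrightarrow> h\<^sub>2 x = h (\<theta> x) \<and> h\<^sub>2 (\<theta> x) = h (\<theta> x)"
  shows "Z2 V E N \<beta> U h \<le> (Z2 V E N \<beta> U h\<^sub>1 + Z2 V E N \<beta> U h\<^sub>2) / 2"
proof -
  let ?Z = "Z_two_point V E N \<beta> U"
  have "Z2 V E N \<beta> U h\<^sub>1 + Z2 V E N \<beta> U h\<^sub>2 - 2 * Z2 V E N \<beta> U h =
      (\<Sum>x\<in>P. \<Sum>y\<in>P. ?Z x (\<theta> y) * (h x - h (\<theta> x)) * (h y - h (\<theta> y)))"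
    unfolding Z2_half_form sum_distrib_left sum.distrib[symmetric] sum_subtractf[symmetric]
    by (intro sum.cong refl) (simp add: plus minus algebra_simps)
  then show ?thesis
    using reflection_positivity[OF assms(1,2), of "\<lambda>x. h x - h (\<theta> x)"] by simp
qed

end
section \<open>Reflections of the torus through edges\<close>

lemma mod_reflect:
  fixes t L :: int
  assumes "L > 0"
  shows "(- 1 - t) mod L = L - 1 - t mod L"
proof -
  have "(- 1 - t) mod L = (L - 1 - t mod L) mod L"
  proof -
    have "(L - 1 - t mod L) mod L = (L - 1 - t) mod L" by (rule mod_diff_right_eq)
    moreover have "L - 1 - t = - 1 - t + L" by simp
    ultimately show ?thesis by (metis mod_add_self2)
  qed
  also have "\<dots> = L - 1 - t mod L"
    using assms pos_mod_bound[of L t] pos_mod_sign[of L t] by (intro mod_pos_pos_trivial) linarith+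
  finally show ?thesis .
qed

lemma mod_shift_cancel:
  fixes u v k L :: int
  assumes "(u - k) mod L = (v - k) mod L" "u \<in> {0..<L}" "v \<in> {0..<L}"
  shows "u = v"
proof -
  have "w mod L = ((w - k) mod L + k) mod L" for w
    by (simp add: mod_add_left_eq)
  then have "u mod L = v mod L" using assms(1) by metis
  then show ?thesis using assms by simp
qed

lemma torus_coordinate: "i < d \<Longrightarrow> x \<in> torus d L \<Longrightarrow> x i \<in> {0..<L}"
  by (simp add: torus_def PiE_iff)

text \<open>
  The distance of \<open>x\<close> from the lowest layer of \<open>half_plus d L i a\<close> along the \<open>i\<close>-th axis, going around
  the torus in the positive direction. In this coordinate the half is \<open>{0..<L div 2}\<close>, the reflection is
  \<open>s \<mapsto> L - 1 - s\<close>, and a step in direction \<open>i\<close> leads from \<open>s\<close> to \<open>(s + 1) mod L\<close>.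
\<close>

definition height :: "int \<Rightarrow> nat \<Rightarrow> int \<Rightarrow> site \<Rightarrow> int" where
  "height L i a x = (x i - (a + 1)) mod L"

lemma half_plus_iff_height:
  assumes "L > 0" "i < d" "x \<in> torus d L"
  shows "x \<in> half_plus d L i a \<longleftrightarrow> height L i a x < L div 2"
proof -
  have x: "x i \<in> {0..<L}" using assms by (intro torus_coordinate)
  have s: "0 \<le> height L i a x" using assms(1) by (simp add: height_def)
  have L: "L div 2 \<le> L" using assms(1) by simp
  have "height L i a x < L div 2" if b: "b \<in> {a + 1..a + L div 2}" "x i = b mod L" for b
  proof -
    have "height L i a x = (b - (a + 1)) mod L"
      unfolding height_def b(2) by (rule mod_diff_left_eq)
    also have "\<dots> = b - (a + 1)"
      by (rule mod_pos_pos_trivial) (use b(1) L in auto)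
    finally show ?thesis using b(1) by auto
  qed
  moreover have "\<exists>b\<in>{a + 1..a + L div 2}. x i = b mod L" if h: "height L i a x < L div 2"
  proof
    have "(a + 1 + height L i a x) mod L = (a + 1 + (x i - (a + 1))) mod L"
      unfolding height_def by (rule mod_add_right_eq)
    also have "\<dots> = x i" using x by simp
    finally show "x i = (a + 1 + height L i a x) mod L" ..
    show "a + 1 + height L i a x \<in> {a + 1..a + L div 2}" using s h by auto
  qed
  ultimately have "(\<exists>b\<in>{a + 1..a + L div 2}. x i = b mod L) \<longleftrightarrow> height L i a x < L div 2"
    by (intro iffI) (elim bexE)
  then show ?thesis using assms(3) by (simp add: half_plus_def)
qed

lemma height_reflect:
  assumes "L > 0"
  shows "height L i a (reflect L i a x) = L - 1 - height L i a x"
proof -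
  have "height L i a (reflect L i a x) = (2 * a + 1 - x i - (a + 1)) mod L"
    by (simp only: height_def reflect_def fun_upd_same mod_diff_left_eq)
  also have "2 * a + 1 - x i - (a + 1) = - 1 - (x i - (a + 1))" by simp
  finally show ?thesis by (simp only: mod_reflect[OF assms] height_def)
qed

lemma reflect_torus:
  assumes "L > 0" "i < d" "x \<in> torus d L"
  shows "reflect L i a x \<in> torus d L"
  using assms by (auto simp: torus_def reflect_def PiE_iff extensional_def)

lemma reflect_reflect:
  assumes "L > 0" "i < d" "x \<in> torus d L"
  shows "reflect L i a (reflect L i a x) = x"
proof -
  have "(2 * a + 1 - (2 * a + 1 - x i) mod L) mod L = x i mod L"
    by (simp add: mod_diff_right_eq)
  also have "\<dots> = x i" using torus_coordinate[OF assms(2,3)] by simp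
  finally show ?thesis by (simp add: reflect_def)
qed

lemma shifted_site_torus:
  assumes "L > 0" "j < d" "x \<in> torus d L"
  shows "x(j := (x j + 1) mod L) \<in> torus d L"
  using assms by (auto simp: torus_def PiE_iff extensional_def)

lemma reflect_edge:
  assumes "L > 0" "i < d" "e \<in> torus_edges d L"
  shows "reflect L i a ` e \<in> torus_edges d L"
proof -
  from assms(3) obtain x j where e: "e = {x, x(j := (x j + 1) mod L)}" and x: "x \<in> torus d L" "j < d"
    by (auto simp: torus_edges_def)
  let ?y = "x(j := (x j + 1) mod L)"
  show ?thesis
  proof (cases "j = i")
    case False
    then have "reflect L i a ?y = (reflect L i a x)(j := (reflect L i a x j + 1) mod L)"
      by (auto simp: reflect_def)
    then show ?thesis using reflect_torus[OF assms(1,2) x(1)] x(2)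
      by (auto simp: torus_edges_def e)
  next
    case True
    have "((2 * a + 1 - (x i + 1) mod L) mod L + 1) mod L = (2 * a + 1 - x i) mod L"
    proof -
      have "2 * a + 1 - x i = 2 * a + 1 - (x i + 1) + 1" by simp
      then show ?thesis by (simp only: mod_add_left_eq mod_diff_right_eq)
    qed
    then have "reflect L i a x = (reflect L i a ?y)(j := (reflect L i a ?y j + 1) mod L)"
      using True by (simp add: reflect_def)
    moreover have "reflect L i a ?y \<in> torus d L"
      using reflect_torus assms(1,2) x shifted_site_torus by blast
    ultimately show ?thesis using x(2) by (auto simp: torus_edges_def e insert_commute)
  qed
qed

text \<open>
  In terms of \<open>height\<close>, only the steps from \<open>L div 2 - 1\<close> to \<open>L div 2\<close> and from \<open>L - 1\<close> to \<open>0\<close> change the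
  half, and \<open>s \<mapsto> L - 1 - s\<close> exchanges the two ends of each of them.
\<close>

lemma crossing_edge_reflect:
  assumes "L > 0" "even L" "i < d" "x \<in> torus d L" "j < d"
    and "y = x(j := (x j + 1) mod L)"
    and "x \<in> half_plus d L i a \<longleftrightarrow> y \<notin> half_plus d L i a"
  shows "reflect L i a x = y"
proof -
  have y: "y \<in> torus d L" using assms shifted_site_torus by blast
  have differ: "height L i a x < L div 2 \<longleftrightarrow> \<not> height L i a y < L div 2"
    using assms(7) half_plus_iff_height[OF assms(1,3)] assms(4) y by simp
  have ji: "j = i"
  proof (rule ccontr)
    assume "j \<noteq> i"
    then have "height L i a y = height L i a x" by (simp add: height_def assms(6))
    then show False using differ by simp
  qed
  have "height L i a y = (height L i a x + 1) mod L"
  proof -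
    have "x i + 1 - (a + 1) = x i - (a + 1) + 1" by simp
    then show ?thesis
      by (simp only: height_def assms(6) ji fun_upd_same mod_diff_left_eq mod_add_left_eq)
  qed
  moreover have "0 \<le> height L i a x" "height L i a x < L"
    using assms(1) by (simp_all add: height_def)
  moreover obtain k where "L = 2 * k" using assms(2) by (rule evenE)
  ultimately have "height L i a y = L - 1 - height L i a x"
    using differ assms(1) by (cases "height L i a x + 1 = L") auto
  then have "height L i a (reflect L i a x) = height L i a y"
    using height_reflect assms by simp
  then have "reflect L i a x i = y i"
    unfolding height_def
    by (rule mod_shift_cancel) (rule torus_coordinate[OF assms(3)] reflect_torus[OF assms(1,3,4)] y)+
  then show ?thesis using assms(6) ji by (auto simp: reflect_def)
qed

text \<open>
  The reflection is extended by the identity to functions that are not sites, where the defining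
  formula with \<open>mod L\<close> is not an involution.
\<close>

lemma torus_reflection_graph:
  assumes "L > 0" "even L" "i < d"
  shows "reflection_graph (torus d L) (torus_edges d L)
    (\<lambda>x. if x \<in> torus d L then reflect L i a x else x) (half_plus d L i a)"
proof
  let ?r = "\<lambda>x. if x \<in> torus d L then reflect L i a x else x"
  show "finite (torus d L)" by (auto simp: torus_def intro: finite_PiE)
  show sub: "e \<subseteq> torus d L" if "e \<in> torus_edges d L" for e
    using that shifted_site_torus[OF assms(1)] by (auto simp: torus_edges_def)
  show "e \<noteq> {}" if "e \<in> torus_edges d L" for e
    using that by (auto simp: torus_edges_def)
  show "?r (?r x) = x" for x
    using reflect_reflect[OF assms(1,3)] reflect_torus[OF assms(1,3)] by simp
  show "?r x \<in> torus d L" if "x \<in> torus d L" for x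
    using reflect_torus[OF assms(1,3)] that by simp
  have image_eq: "?r ` e = reflect L i a ` e" if "e \<in> torus_edges d L" for e
    using sub[OF that] by (intro image_cong) auto
  show "?r ` e \<in> torus_edges d L" if "e \<in> torus_edges d L" for e
    unfolding image_eq[OF that] by (rule reflect_edge[OF assms(1,3) that])
  show "half_plus d L i a \<subseteq> torus d L" by (auto simp: half_plus_def)
  show "?r x \<in> half_plus d L i a \<longleftrightarrow> x \<notin> half_plus d L i a" if "x \<in> torus d L" for x
    using half_plus_iff_height[OF assms(1,3)] reflect_torus[OF assms(1,3)] that
      height_reflect[OF assms(1), of i a x] assms(2) by (auto elim!: evenE)
  show "?r ` e = e" if e: "e \<in> torus_edges d L" and cross: "\<not> e \<subseteq> half_plus d L i a"
    "e \<inter> half_plus d L i a \<noteq> {}" for e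
  proof -
    from e obtain x j where xj: "e = {x, x(j := (x j + 1) mod L)}" "x \<in> torus d L" "j < d"
      by (auto simp: torus_edges_def)
    define y where "y = x(j := (x j + 1) mod L)"
    have "x \<in> half_plus d L i a \<longleftrightarrow> y \<notin> half_plus d L i a"
      using cross by (auto simp: xj y_def[symmetric])
    then have "reflect L i a x = y"
      by (rule crossing_edge_reflect[OF assms xj(2,3) y_def])
    moreover from this have "reflect L i a y = x"
      using reflect_reflect[OF assms(1,3) xj(2)] by auto
    ultimately show "?r ` e = e"
      unfolding image_eq[OF e] by (auto simp: xj(1) y_def[symmetric])
  qed
qed

theorem theorem3p4:
  fixes d N i :: nat and L a :: int and \<beta> :: real and U :: weight and h :: "site \<Rightarrow> real"
  assumes "d \<ge> 2" and "L > 0" and "even L"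
    and "i < d" and "0 \<le> a" and "a < L"
    and "N > 0" and "\<beta> \<ge> 0" and "nonneg_weight N U"
    and "finite_mass (torus d L) (torus_edges d L) N \<beta> U"
    and "\<And>k :: site \<Rightarrow> real. (\<forall>x \<in> torus d L. k x \<le> 1) \<Longrightarrow>
           Z_field_finite (torus d L) (torus_edges d L) N \<beta> U k"
  shows "Z2 (torus d L) (torus_edges d L) N \<beta> U h \<le>
           (Z2 (torus d L) (torus_edges d L) N \<beta> U
              (reflected_field (half_plus d L i a) (reflect L i a) h) +
            Z2 (torus d L) (torus_edges d L) N \<beta> U
              (reflected_field (half_minus d L i a) (reflect L i a) h)) / 2"
proof -
  interpret reflection_graph "torus d L" "torus_edges d L"
    "\<lambda>x. if x \<in> torus d L then reflect L i a x else x" "half_plus d L i a"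
    by (rule torus_reflection_graph[OF assms(2-4)])
  have x: "x \<in> torus d L \<and> reflect L i a x \<in> torus d L \<and> reflect L i a x \<notin> half_plus d L i a \<and>
      reflect L i a (reflect L i a x) = x" if "x \<in> half_plus d L i a" for x
  proof -
    have "x \<in> torus d L" using that half_subset by blast
    then show ?thesis
      using that reflect_half[of x] reflect_torus[OF assms(2,4)] reflect_reflect[OF assms(2,4)]
      by simp
  qed
  show ?thesis
    by (rule Z2_reflection_bound[OF assms(8,10)])
       (auto simp: reflected_field_def half_minus_def x)
qed

end
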